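(* Let $f:\mathbb{R}^M\to\mathbb{R}$ be a black-box regression function possessing derivatives of arbitrary order, and let $F(\bm{x},y)=f(\bm{x})-y$ be the deviation function. Let $(\bm{x}^t,y^t)\in\mathbb{R}^M\times\mathbb{R}$ be a test sample, and let $P(\bm{x},y)$ be a joint probability density on $\mathbb{R}^M\times\mathbb{R}$ with marginal density $P(\bm{x})=\int P(\bm{x},y)\,\mathrm{d}y$. Then the integrated gradient (IG) and the expected integrated gradient (EIG) applied to $F$ are deviation-agnostic: for every $i\in\{1,\ldots,M\}$ and every baseline input $(\bm{x}^0,y^0)\in\mathbb{R}^M\times\mathbb{R}$, $$\mathrm{IG}_i(\bm{x}^t,y^t\mid\bm{x}^0,y^0)=\mathrm{IG}_i(\bm{x}^t\mid\bm{x}^0)\quad\text{and}\quad \mathrm{EIG}_i(\bm{x}^t,y^t)=\mathrm{EIG}_i(\bm{x}^t).$$ In particular, neither score changes if $y^t$ is replaced by $y^t+\Delta$, for any $\Delta\in\mathbb{R}$.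
   Context: An anomaly attribution method $A$, which assigns to each function $f$, test sample $(\bm{x}^t,y^t)$ and input-variable index $i$ a score $A_{f,i}(\bm{x}^t,y^t)$, is called deviation-agnostic if for any $f$, $(\bm{x}^t,y^t)$, $\Delta\in\mathbb{R}$ and $i$ one has $A_{f,i}(\bm{x}^t,y^t)=A_{f,i}(\bm{x}^t,y^t+\Delta)$. Scores of the deviation function $F$: $$\mathrm{IG}_i(\bm{x}^t,y^t\mid\bm{x}^0,y^0)=(x_i^t-x_i^0)\int_0^1\mathrm{d}\alpha\,\left.\frac{\partial F}{\partial x_i}\right|_{\alpha},$$ where the partial derivative is evaluated at $\bm{x}=\bm{x}^0+(\bm{x}^t-\bm{x}^0)\alpha$, $y=y^0+(y^t-y^0)\alpha$, and $$\mathrm{EIG}_i(\bm{x}^t,y^t)=\int\mathrm{d}y^0\int\mathrm{d}\bm{x}^0\,P(\bm{x}^0,y^0)\,\mathrm{IG}_i(\bm{x}^t,y^t\mid\bm{x}^0,y^0).$$ Scores of $f$ itself: $$\mathrm{IG}_i(\bm{x}^t\mid\bm{x}^0)=(x_i^t-x_i^0)\int_0^1\mathrm{d}\alpha\,\left.\frac{\partial f}{\partial x_i}\right|_{\bm{x}^0+(\bm{x}^t-\bm{x}^0)\alpha},\qquad \mathrm{EIG}_i(\bm{x}^t)=\int\mathrm{d}\bm{x}^0\,P(\bm{x}^0)\,\mathrm{IG}_i(\bm{x}^t\mid\bm{x}^0).$$ The integrals defining the EIG scores are assumed to converge absolutely. *)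

theory Defs
  imports "HOL-Analysis.Analysis"
begin

text \<open>
  On a finite-dimensional space a map is \<open>Suc k\<close> times differentiable iff it is differentiable
  and all its directional derivatives are \<open>k\<close> times differentiable.
\<close>

primrec times_differentiable :: "nat \<Rightarrow> ('a::euclidean_space \<Rightarrow> real) \<Rightarrow> bool" where
  "times_differentiable 0 f \<longleftrightarrow> True"
| "times_differentiable (Suc k) f \<longleftrightarrow>
     (\<forall>x. f differentiable (at x)) \<and>
     (\<forall>v. times_differentiable k (\<lambda>x. frechet_derivative f (at x) v))"

definition smooth :: "('a::euclidean_space \<Rightarrow> real) \<Rightarrow> bool" where
  "smooth f \<longleftrightarrow> (\<forall>k. times_differentiable k f)"

definition partial_deriv :: "'n::finite \<Rightarrow> (real^'n \<Rightarrow> real) \<Rightarrow> real^'n \<Rightarrow> real" where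
  "partial_deriv i g x = deriv (\<lambda>t. g (x + t *\<^sub>R axis i 1)) 0"

definition deviation :: "(real^'n \<Rightarrow> real) \<Rightarrow> real^'n \<Rightarrow> real \<Rightarrow> real" where
  "deviation f x y = f x - y"

definition prob_density :: "('a::euclidean_space \<Rightarrow> real) \<Rightarrow> bool" where
  "prob_density P \<longleftrightarrow> (\<forall>z. 0 \<le> P z) \<and> has_bochner_integral lborel P 1"

definition marginal_density :: "((real^'n) \<times> real \<Rightarrow> real) \<Rightarrow> real^'n \<Rightarrow> real" where
  "marginal_density P x = (LINT y|lborel. P (x, y))"

definition IG :: "(real^'n \<Rightarrow> real) \<Rightarrow> 'n::finite \<Rightarrow> real^'n \<Rightarrow> real^'n \<Rightarrow> real" where
  "IG f i xt x0 =
     (xt $ i - x0 $ i) * integral {0..1} (\<lambda>\<alpha>. partial_deriv i f (x0 + \<alpha> *\<^sub>R (xt - x0)))"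

text \<open>In \<open>EIG\<close> the density \<open>p\<close> is that of the input baseline alone.\<close>

definition EIG :: "(real^'n \<Rightarrow> real) \<Rightarrow> (real^'n \<Rightarrow> real) \<Rightarrow> 'n::finite \<Rightarrow> real^'n \<Rightarrow> real" where
  "EIG p f i xt = (LINT x0|lborel. p x0 * IG f i xt x0)"

text \<open>
  The scores with suffix \<open>_dev\<close> are for functions \<open>F\<close> of an input and an output value; the
  derivative is with respect to the input coordinate \<open>i\<close>, the path moves both arguments.
\<close>

definition IG_dev ::
    "(real^'n \<Rightarrow> real \<Rightarrow> real) \<Rightarrow> 'n::finite \<Rightarrow> real^'n \<Rightarrow> real \<Rightarrow> real^'n \<Rightarrow> real \<Rightarrow> real" where
  "IG_dev F i xt yt x0 y0 =
     (xt $ i - x0 $ i) *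
     integral {0..1} (\<lambda>\<alpha>. partial_deriv i (\<lambda>x. F x (y0 + \<alpha> * (yt - y0))) (x0 + \<alpha> *\<^sub>R (xt - x0)))"

definition EIG_dev ::
    "((real^'n) \<times> real \<Rightarrow> real) \<Rightarrow> (real^'n \<Rightarrow> real \<Rightarrow> real) \<Rightarrow> 'n::finite \<Rightarrow> real^'n \<Rightarrow> real \<Rightarrow> real" where
  "EIG_dev P F i xt yt =
     (LINT y0|lborel. LINT x0|lborel. P (x0, y0) * IG_dev F i xt yt x0 y0)"

text \<open>An attribution method maps a function, an input index and a test sample to a score.\<close>

definition deviation_agnostic ::
    "((real^'n \<Rightarrow> real) \<Rightarrow> 'n::finite \<Rightarrow> real^'n \<Rightarrow> real \<Rightarrow> real) \<Rightarrow> bool" where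
  "deviation_agnostic A \<longleftrightarrow> (\<forall>f xt yt \<Delta> i. A f i xt yt = A f i xt (yt + \<Delta>))"

end

theory Submission imports Defs begin

text \<open>The output enters \<open>deviation f\<close> only as a subtracted term that is constant
  in the input, so along the path its partial derivatives are those of \<open>f\<close>
  (\<open>deriv_diff_const\<close>). Hence its integrated gradient is that of \<open>f\<close>, free
  of both \<open>yt\<close> and \<open>y0\<close>. In the expected score \<open>y0\<close> then
  survives only in the density; Fubini brings its integral inside, where it yields the marginal
  (\<open>EIG_dev_deviation\<close>).\<close>

text \<open>
  Where \<open>g\<close> is not differentiable, \<open>deriv\<close> is a choice from the empty predicate, the same
  one on both sides.
\<close>

lemma deriv_diff_const: "deriv (\<lambda>t. g t - c) x = deriv g x"
proof -
  have "((\<lambda>t. g t - c) has_field_derivative D) (at x) \<longleftrightarrow> (g has_field_derivative D) (at x)" for D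
    using DERIV_diff[OF _ DERIV_const[of c], of g D x UNIV]
      DERIV_add[OF _ DERIV_const[of c], of "\<lambda>t. g t - c" D x UNIV]
    by auto
  then show ?thesis
    by (simp add: deriv_def)
qed

lemma IG_dev_deviation: "IG_dev (deviation f) i xt yt x0 y0 = IG f i xt x0"
  unfolding IG_dev_def IG_def partial_deriv_def deviation_def deriv_diff_const ..

lemma EIG_dev_deviation:
  assumes "integrable lborel (\<lambda>(x0, y0). P (x0, y0) * IG_dev (deviation f) i xt yt x0 y0)"
  shows "EIG_dev P (deviation f) i xt yt = EIG (marginal_density P) f i xt"
proof -
  have "integrable (lborel \<Otimes>\<^sub>M lborel) (\<lambda>(x0, y0). P (x0, y0) * IG f i xt x0)"
    using assms by (simp add: IG_dev_deviation lborel_prod)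
  then have "(LINT y0|lborel. LINT x0|lborel. P (x0, y0) * IG f i xt x0)
      = (LINT x0|lborel. LINT y0|lborel. P (x0, y0) * IG f i xt x0)"
    by (rule lborel_pair.Fubini_integral)
  \<comment> \<open>The \<open>IG\<close> factor leaves the inner integral over \<open>y0\<close>
    even when the slice of \<open>P\<close> is not integrable: both sides are then 0.\<close>
  then show ?thesis
    by (simp add: EIG_dev_def EIG_def marginal_density_def IG_dev_deviation)
qed

theorem theorem2:
  fixes f :: "real^'n::finite \<Rightarrow> real"
    and P :: "(real^'n) \<times> real \<Rightarrow> real"
    and xt :: "real^'n" and yt :: real
  assumes "smooth f"
    and "prob_density P"
    and "\<forall>i. integrable lborel (\<lambda>(x0, y0). P (x0, y0) * IG_dev (deviation f) i xt yt x0 y0)"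
    and "\<forall>i. integrable lborel (\<lambda>x0. marginal_density P x0 * IG f i xt x0)"
  shows "(\<forall>i x0 y0. IG_dev (deviation f) i xt yt x0 y0 = IG f i xt x0)
    \<and> (\<forall>i. EIG_dev P (deviation f) i xt yt = EIG (marginal_density P) f i xt)
    \<and> (\<forall>i x0 y0 \<Delta>. IG_dev (deviation f) i xt (yt + \<Delta>) x0 y0 = IG_dev (deviation f) i xt yt x0 y0)
    \<and> (\<forall>i \<Delta>. EIG_dev P (deviation f) i xt (yt + \<Delta>) = EIG_dev P (deviation f) i xt yt)
    \<and> (\<forall>(x0::real^'n) y0. deviation_agnostic (\<lambda>g i x y. IG_dev (deviation g) i x y x0 y0))
    \<and> deviation_agnostic (\<lambda>g. EIG_dev P (deviation g))"
proof (intro conjI)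
  show "\<forall>i. EIG_dev P (deviation f) i xt yt = EIG (marginal_density P) f i xt"
    using assms(3) by (blast intro: EIG_dev_deviation)
\<comment> \<open>Agnosticism of \<open>EIG_dev\<close> ranges over all functions, whose integrals
  may diverge, so it rests on equality of the integrands instead of on Fubini.\<close>
qed (simp_all add: deviation_agnostic_def IG_dev_deviation EIG_dev_def)

end
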